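(* Let $V$, $M$, $O$ be real Hilbert spaces, let $b : V \times M \to \mathbb{R}$ be a continuous bilinear form, let $B : V \to M$ be the operator defined by $(Bu, \lambda)_M = b(u,\lambda)$ for all $(u,\lambda) \in V \times M$, and let $C : V \to O$ be a continuous linear operator. Assume that the operator $A : V \to M \times O$, $Au = (Bu, Cu)$, is injective. Let $f \in O$. Then for every $\varepsilon > 0$ the problem: find $(u_\varepsilon, \lambda_\varepsilon) \in V \times M$ such that for all $(v,\mu) \in V \times M$, $$\begin{cases} \varepsilon (u_\varepsilon, v)_V + (C u_\varepsilon, C v)_O + b(v, \lambda_\varepsilon) = (f, Cv)_O, \\ b(u_\varepsilon, \mu) - (\lambda_\varepsilon, \mu)_M = 0, \end{cases}$$ has a unique solution. Furthermore, if there exists $u \in V$ such that $Bu = 0$ and $Cu = f$, then $(u_\varepsilon, \lambda_\varepsilon) \to (u, 0)$ in $V \times M$ when $\varepsilon \to 0$.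
   Context: $(\cdot,\cdot)_V$, $(\cdot,\cdot)_M$, $(\cdot,\cdot)_O$ denote the scalar products of the respective Hilbert spaces; $M \times O$ and $V\times M$ carry the product Hilbert structure. *)

theory Defs
  imports "HOL-Analysis.Analysis"
begin

text \<open>
  A real Hilbert space is a type of sort \<open>{real_inner, complete_space}\<close>. The product type
  carries the inner product \<open>(x, y) \<bullet> (x', y') = x \<bullet> x' + y \<bullet> y'\<close>.
\<close>

text \<open>
  The operator \<open>B\<close> with \<open>B u \<bullet> l = b u l\<close>. The description is meaningful for continuous
  bilinear \<open>b\<close> on Hilbert spaces by the Riesz representation theorem; see
  \<open>assoc_op_inner\<close> and \<open>assoc_op_unique\<close> below.
\<close>

definition assoc_op ::
  "('v::{real_inner, complete_space} \<Rightarrow> 'm::{real_inner, complete_space} \<Rightarrow> real) \<Rightarrow> 'v \<Rightarrow> 'm"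
  where "assoc_op b u = (THE w. \<forall>l. w \<bullet> l = b u l)"

definition solves_mixed ::
  "('v::{real_inner, complete_space} \<Rightarrow> 'm::{real_inner, complete_space} \<Rightarrow> real) \<Rightarrow>
   ('v \<Rightarrow> 'o::{real_inner, complete_space}) \<Rightarrow> 'o \<Rightarrow> real \<Rightarrow> 'v \<times> 'm \<Rightarrow> bool"
  where "solves_mixed b C f \<epsilon> = (\<lambda>(u, l). \<forall>v \<mu>.
    \<epsilon> * (u \<bullet> v) + C u \<bullet> C v + b v l = f \<bullet> C v \<and>
    b u \<mu> - l \<bullet> \<mu> = 0)"

lemma riesz_representation_exists:
  fixes g :: "'m::{real_inner, complete_space} \<Rightarrow> real"
  assumes "bounded_linear g"
  shows "\<exists>w. \<forall>l. w \<bullet> l = g l"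
proof -
  interpret g: bounded_linear g by fact
  define J where "J x = x \<bullet> x - 2 * g x" for x
  obtain K where K: "\<And>x. norm (g x) \<le> norm x * K"
    using g.bounded by blast
  have lower: "- (K\<^sup>2) \<le> J x" for x
  proof -
    have "g x \<le> norm x * K" using K[of x] by simp
    moreover have "0 \<le> (norm x - K)\<^sup>2" by simp
    ultimately show ?thesis
      unfolding J_def by (simp add: power2_diff dot_square_norm algebra_simps)
  qed
  have bdd: "bdd_below (range J)" by (rule bdd_belowI2) (rule lower)
  define m where "m = Inf (range J)"
  have m_le: "m \<le> J x" for x unfolding m_def using bdd by (simp add: cInf_lower)
  have "\<exists>x. J x < m + inverse (real (Suc n))" for n
    using cInf_lessD[of "range J" "m + inverse (real (Suc n))"] unfolding m_def by auto
  then obtain X where X: "\<And>n. J (X n) < m + inverse (real (Suc n))" by metis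
  have par: "(norm (x - y))\<^sup>2 \<le> 2 * J x + 2 * J y - 4 * m" for x y
  proof -
    have "(norm (x - y))\<^sup>2 = 2 * J x + 2 * J y - 4 * J ((1/2) *\<^sub>R (x + y))"
      unfolding J_def power2_norm_eq_inner
      by (simp add: g.scaleR g.add inner_simps inner_commute algebra_simps)
    then show ?thesis using m_le[of "(1/2) *\<^sub>R (x + y)"] by simp
  qed
  have "Cauchy X"
  proof (rule metric_CauchyI)
    fix e :: real assume e: "0 < e"
    obtain N where N: "inverse (real (Suc N)) < e\<^sup>2 / 4"
      using reals_Archimedean[of "e\<^sup>2 / 4"] e by auto
    have close: "J (X n) < m + e\<^sup>2 / 4" if "N \<le> n" for n
    proof -
      have "inverse (real (Suc n)) \<le> inverse (real (Suc N))" using that by simp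
      then show ?thesis using X[of n] N by linarith
    qed
    have "dist (X i) (X j) < e" if "N \<le> i" "N \<le> j" for i j
    proof -
      have "(norm (X i - X j))\<^sup>2 < e\<^sup>2"
        using par[of "X i" "X j"] close[OF that(1)] close[OF that(2)] by linarith
      then show ?thesis using e by (simp add: dist_norm power2_less_imp_less)
    qed
    then show "\<exists>M. \<forall>i\<ge>M. \<forall>j\<ge>M. dist (X i) (X j) < e" by blast
  qed
  then obtain w where w: "X \<longlonglongrightarrow> w" using Cauchy_convergent convergent_def by blast
  have "(\<lambda>n. J (X n)) \<longlonglongrightarrow> J w" unfolding J_def by (intro tendsto_intros g.tendsto w)
  moreover have "(\<lambda>n. m + inverse (real (Suc n))) \<longlonglongrightarrow> m + 0"
    by (intro tendsto_intros LIMSEQ_inverse_real_of_nat)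
  ultimately have "J w \<le> m + 0"
    using X by (intro LIMSEQ_le) (auto intro: less_imp_le)
  then have min: "J w \<le> J y" for y using m_le[of y] by simp
  have "w \<bullet> l = g l" for l
  proof -
    define d where "d = w \<bullet> l - g l"
    define s where "s = l \<bullet> l + 1"
    have s: "s > 0" "l \<bullet> l < s" unfolding s_def by (simp_all add: add_nonneg_pos)
    have "J (w + t *\<^sub>R l) = J w + 2 * t * d + t\<^sup>2 * (l \<bullet> l)" for t
      unfolding J_def d_def
      by (simp add: g.scaleR g.add inner_simps inner_commute algebra_simps power2_eq_square)
    from this[of "- d / s"]
    have "J (w + (- d / s) *\<^sub>R l) = J w - 2 * (d / s) * d + (d / s)\<^sup>2 * (l \<bullet> l)"
      by simp
    with min[of "w + (- d / s) *\<^sub>R l"]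
    have "2 * (d / s) * d \<le> (d / s)\<^sup>2 * (l \<bullet> l)" by simp
    also have "\<dots> \<le> (d / s)\<^sup>2 * s" using s by (intro mult_left_mono) auto
    also have "\<dots> = (d / s) * d" using s by (simp add: power2_eq_square)
    finally have "d * d / s \<le> 0" by simp
    then have "d = 0" using s by (auto simp: divide_le_0_iff mult_le_0_iff)
    then show ?thesis by (simp add: d_def)
  qed
  then show ?thesis by blast
qed

lemma assoc_op_unique:
  assumes "\<And>l. w \<bullet> l = b u l"
  shows "assoc_op b u = w"
  unfolding assoc_op_def
proof (rule the_equality)
  show "\<forall>l. w \<bullet> l = b u l" using assms by blast
next
  fix w' assume "\<forall>l. w' \<bullet> l = b u l"
  then have "(w' - w) \<bullet> (w' - w) = 0" using assms by (simp add: inner_diff_left)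
  then show "w' = w" by simp
qed

lemma assoc_op_inner:
  assumes "bounded_bilinear b"
  shows "assoc_op b u \<bullet> l = b u l"
proof -
  obtain w where "\<forall>l. w \<bullet> l = b u l"
    using riesz_representation_exists[OF bounded_bilinear.bounded_linear_right[OF assms]] by blast
  then show ?thesis using assoc_op_unique by metis
qed

end

theory Submission
  imports Defs
begin

text \<open>
  With adjoints written as stars, the mixed system is the single equation
  \<open>(\<epsilon> u + C* (C u) + B* l, l - B u) = (C* f, 0)\<close> in \<open>V \<times> M\<close>. In the inner product of the left side
  with \<open>(u, l)\<close> the two \<open>B\<close> terms cancel, which leaves \<open>\<epsilon> \<parallel>u\<parallel>\<^sup>2 + \<parallel>C u\<parallel>\<^sup>2 + \<parallel>l\<parallel>\<^sup>2\<close>. The operator is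
  therefore coercive with constant \<open>min \<epsilon> 1\<close>, and the Lax--Milgram theorem (\<open>lax_milgram\<close>) gives
  existence and uniqueness together.

  For the limit, put \<open>A v = (B v, C v)\<close>. The second line says \<open>l\<^sub>\<epsilon> = B u\<^sub>\<epsilon>\<close>; if \<open>A u = (0, f)\<close>,
  eliminating \<open>l\<^sub>\<epsilon>\<close> turns the first line into the Euler equation
  \<open>\<epsilon> (u\<^sub>\<epsilon> \<bullet> v) + A (u\<^sub>\<epsilon> - u) \<bullet> A v = 0\<close> of Tikhonov regularization. Since \<open>A\<close> need not be
  bounded below, the smallness of \<open>A (u\<^sub>\<epsilon> - u)\<close> says nothing directly about \<open>u\<^sub>\<epsilon> - u\<close>. Compactness
  comes instead from monotonicity: comparing two parameters \<open>\<eta> \<le> \<epsilon>\<close> gives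
  \<open>\<parallel>u\<^sub>\<epsilon> - u\<^sub>\<eta>\<parallel>\<^sup>2 \<le> \<parallel>u\<^sub>\<eta>\<parallel>\<^sup>2 - \<parallel>u\<^sub>\<epsilon>\<parallel>\<^sup>2\<close>. The norms grow as the parameter decreases and stay at most
  \<open>\<parallel>u\<parallel>\<close>, so the family is Cauchy and converges strongly. Its limit has the same image under \<open>A\<close>
  as \<open>u\<close>, and injectivity identifies it with \<open>u\<close>
  (\<open>tikhonov_convergence\<close>).
\<close>

lemma bounded_linear_assoc_op:
  fixes b :: "'v::{real_inner, complete_space} \<Rightarrow> 'm::{real_inner, complete_space} \<Rightarrow> real"
  assumes b: "bounded_bilinear b"
  shows "bounded_linear (assoc_op b)"
proof -
  interpret bounded_bilinear b by fact
  note inner = assoc_op_inner[OF b]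
  obtain K where K0: "0 \<le> K" and K: "\<And>x y. norm (b x y) \<le> norm x * norm y * K"
    using nonneg_bounded by blast
  show ?thesis
  proof (rule bounded_linear_intro)
    show "assoc_op b (x + y) = assoc_op b x + assoc_op b y" for x y
      by (rule assoc_op_unique) (simp add: inner_add_left inner add_left)
    show "assoc_op b (r *\<^sub>R x) = r *\<^sub>R assoc_op b x" for r x
      by (rule assoc_op_unique) (simp add: inner scaleR_left)
    show "norm (assoc_op b x) \<le> norm x * K" for x
    proof (cases "assoc_op b x = 0")
      case True
      then show ?thesis using K0 by simp
    next
      case False
      have "norm (assoc_op b x) * norm (assoc_op b x) \<le> (norm x * K) * norm (assoc_op b x)"
        using K[of x "assoc_op b x"] inner[of x "assoc_op b x"]
        by (simp add: dot_square_norm power2_eq_square mult_ac)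
      then show ?thesis using False by simp
    qed
  qed
qed

text \<open>
  For small \<open>\<rho> > 0\<close> the Richardson iteration \<open>x \<mapsto> x - \<rho> (T x - g)\<close> is a contraction:
  \<open>\<parallel>d - \<rho> T d\<parallel>\<^sup>2 \<le> (1 - 2 \<rho> \<alpha> + \<rho>\<^sup>2 L\<^sup>2) \<parallel>d\<parallel>\<^sup>2\<close> when \<open>L\<close> bounds \<open>T\<close>. Its fixed points are the
  solutions of \<open>T x = g\<close>.
\<close>

lemma lax_milgram:
  fixes T :: "'a::{real_inner, complete_space} \<Rightarrow> 'a"
  assumes "bounded_linear T" and \<alpha>: "0 < \<alpha>"
    and coercive: "\<And>x. \<alpha> * (x \<bullet> x) \<le> T x \<bullet> x"
  shows "\<exists>!x. T x = g"
proof -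
  interpret bounded_linear T by fact
  obtain K where K0: "0 < K" and K: "\<And>x. norm (T x) \<le> norm x * K"
    using pos_bounded by blast
  \<comment> \<open>Enlarging the bound beyond \<open>\<alpha>\<close> makes the radicand of the contraction factor \<open>c\<close> nonnegative.\<close>
  define L where "L = K + \<alpha>"
  have L: "\<alpha> < L" "0 < L" using K0 \<alpha> by (simp_all add: L_def)
  \<comment> \<open>This \<open>\<rho>\<close> minimizes \<open>1 - 2 \<rho> \<alpha> + \<rho>\<^sup>2 L\<^sup>2\<close>.\<close>
  define \<rho> where "\<rho> = \<alpha> / L\<^sup>2"
  have \<rho>: "0 < \<rho>" using \<alpha> L by (simp add: \<rho>_def)
  define c where "c = sqrt (1 - (\<alpha> / L)\<^sup>2)"
  have q: "0 < (\<alpha> / L)\<^sup>2" "(\<alpha> / L)\<^sup>2 \<le> 1"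
    using \<alpha> L by (simp_all add: power_le_one)
  have c: "0 \<le> c" "c < 1" "c\<^sup>2 = 1 - (\<alpha> / L)\<^sup>2"
    using q by (simp_all add: c_def)
  have contract: "norm (d - \<rho> *\<^sub>R T d) \<le> c * norm d" for d
  proof (rule power2_le_imp_le)
    have "norm (T d) \<le> L * norm d"
      using K[of d] \<alpha> by (simp add: L_def algebra_simps add_increasing2)
    then have "(norm (T d))\<^sup>2 \<le> (L * norm d)\<^sup>2" by (intro power_mono) auto
    then have Td: "T d \<bullet> T d \<le> L\<^sup>2 * (d \<bullet> d)"
      by (simp add: dot_square_norm power_mult_distrib)
    have "(norm (d - \<rho> *\<^sub>R T d))\<^sup>2 = d \<bullet> d - 2 * \<rho> * (T d \<bullet> d) + \<rho>\<^sup>2 * (T d \<bullet> T d)"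
      unfolding power2_norm_eq_inner
      by (simp add: inner_diff inner_commute power2_eq_square algebra_simps)
    also have "\<dots> \<le> d \<bullet> d - 2 * \<rho> * (\<alpha> * (d \<bullet> d)) + \<rho>\<^sup>2 * (L\<^sup>2 * (d \<bullet> d))"
      using \<rho> by (intro add_mono diff_left_mono mult_left_mono coercive Td) auto
    also have "\<dots> = (1 - 2 * \<rho> * \<alpha> + \<rho>\<^sup>2 * L\<^sup>2) * (d \<bullet> d)" by (simp add: algebra_simps)
    also have "1 - 2 * \<rho> * \<alpha> + \<rho>\<^sup>2 * L\<^sup>2 = c\<^sup>2"
      using L unfolding c(3) \<rho>_def by (simp add: field_simps power2_eq_square)
    finally show "(norm (d - \<rho> *\<^sub>R T d))\<^sup>2 \<le> (c * norm d)\<^sup>2"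
      by (simp add: dot_square_norm power_mult_distrib)
    show "0 \<le> c * norm d" using c by simp
  qed
  have "\<exists>!x. x - \<rho> *\<^sub>R (T x - g) = x"
  proof (rule banach_fix_type[OF c(1,2)], intro allI)
    fix x y
    have "x - \<rho> *\<^sub>R (T x - g) - (y - \<rho> *\<^sub>R (T y - g)) = (x - y) - \<rho> *\<^sub>R T (x - y)"
      by (simp add: diff algebra_simps)
    then show "dist (x - \<rho> *\<^sub>R (T x - g)) (y - \<rho> *\<^sub>R (T y - g)) \<le> c * dist x y"
      using contract[of "x - y"] by (simp only: dist_norm)
  qed
  then show ?thesis using \<rho> by simp
qed

text \<open>
  The hypothesis on \<open>X \<epsilon>\<close> is the Euler equation for minimizing
  \<open>\<epsilon> \<parallel>x\<parallel>\<^sup>2 + \<parallel>A x - A u\<parallel>\<^sup>2\<close>. Testing it with \<open>X \<epsilon> - u\<close> bounds \<open>X \<epsilon>\<close> and the residual. Testing the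
  difference of the equations for \<open>\<epsilon>\<close> and \<open>\<eta>\<close> with \<open>X \<epsilon> - X \<eta>\<close> bounds distances by differences
  of squared norms, which replaces weak compactness by convergence of a bounded monotone sequence of
  numbers.
\<close>

lemma tikhonov_convergence:
  fixes A :: "'v::{real_inner, complete_space} \<Rightarrow> 'h::real_inner"
  assumes "bounded_linear A" and "inj A"
    and euler: "\<And>\<epsilon> v. 0 < \<epsilon> \<Longrightarrow> \<epsilon> * (X \<epsilon> \<bullet> v) + A (X \<epsilon> - u) \<bullet> A v = 0"
  shows "(X \<longlongrightarrow> u) (at_right 0)"
proof -
  interpret A: bounded_linear A by fact
  have energy: "norm (X \<epsilon>) \<le> norm u \<and> (norm (A (X \<epsilon> - u)))\<^sup>2 \<le> \<epsilon> * (2 * (norm u)\<^sup>2)"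
    if "0 < \<epsilon>" for \<epsilon>
  proof -
    have id: "\<epsilon> * (X \<epsilon> \<bullet> X \<epsilon>) + (norm (A (X \<epsilon> - u)))\<^sup>2 = \<epsilon> * (X \<epsilon> \<bullet> u)"
      using euler[OF that, of "X \<epsilon> - u"]
      by (simp add: power2_norm_eq_inner inner_diff_right algebra_simps)
    have "\<epsilon> * (X \<epsilon> \<bullet> X \<epsilon>) \<le> \<epsilon> * (X \<epsilon> \<bullet> u)"
      using id zero_le_power2[of "norm (A (X \<epsilon> - u))"] by linarith
    then have "X \<epsilon> \<bullet> X \<epsilon> \<le> X \<epsilon> \<bullet> u" using that by simp
    also have "\<dots> \<le> norm (X \<epsilon>) * norm u" by (rule norm_cauchy_schwarz)
    finally have "norm (X \<epsilon>) * norm (X \<epsilon>) \<le> norm (X \<epsilon>) * norm u"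
      by (simp add: dot_square_norm power2_eq_square)
    then have le: "norm (X \<epsilon>) \<le> norm u" by (cases "X \<epsilon> = 0") auto
    have "X \<epsilon> \<bullet> u \<le> norm (X \<epsilon>) * norm u" by (rule norm_cauchy_schwarz)
    also have "\<dots> \<le> norm u * norm u" by (intro mult_right_mono le) auto
    finally have "\<epsilon> * (X \<epsilon> \<bullet> u) \<le> \<epsilon> * (norm u)\<^sup>2"
      using that by (simp add: power2_eq_square)
    moreover have "0 \<le> \<epsilon> * (X \<epsilon> \<bullet> X \<epsilon>)" "0 \<le> \<epsilon> * (norm u)\<^sup>2" using that by simp_all
    ultimately have "(norm (A (X \<epsilon> - u)))\<^sup>2 \<le> \<epsilon> * (2 * (norm u)\<^sup>2)"
      using id by linarith
    with le show ?thesis by simp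
  qed
  have dist_le: "(norm (X \<epsilon> - X \<eta>))\<^sup>2 \<le> (norm (X \<eta>))\<^sup>2 - (norm (X \<epsilon>))\<^sup>2"
    if "0 < \<eta>" "\<eta> \<le> \<epsilon>" for \<epsilon> \<eta>
  proof (cases "\<eta> = \<epsilon>")
    case False
    define d where "d = X \<epsilon> - X \<eta>"
    have "A d = A (X \<epsilon> - u) - A (X \<eta> - u)" by (simp add: d_def A.diff)
    then have "A d \<bullet> A d = A (X \<epsilon> - u) \<bullet> A d - A (X \<eta> - u) \<bullet> A d"
      by (simp add: inner_diff_left)
    moreover have "\<epsilon> * (X \<epsilon> \<bullet> d) + A (X \<epsilon> - u) \<bullet> A d = 0"
      and "\<eta> * (X \<eta> \<bullet> d) + A (X \<eta> - u) \<bullet> A d = 0"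
      using euler that by auto
    ultimately have "\<epsilon> * (X \<epsilon> \<bullet> d) - \<eta> * (X \<eta> \<bullet> d) \<le> 0"
      using inner_ge_zero[of "A d"] by linarith
    moreover have "X \<eta> = X \<epsilon> - d" by (simp add: d_def)
    ultimately have "(\<epsilon> - \<eta>) * (X \<epsilon> \<bullet> d) + \<eta> * (d \<bullet> d) \<le> 0"
      by (simp add: inner_diff_left algebra_simps)
    moreover have "0 \<le> \<eta> * (d \<bullet> d)" using that by simp
    ultimately have "(\<epsilon> - \<eta>) * (X \<epsilon> \<bullet> d) \<le> 0" by linarith
    then have "X \<epsilon> \<bullet> d \<le> 0" using that False by (simp add: mult_le_0_iff)
    then show ?thesis
      by (simp add: d_def power2_norm_eq_inner inner_diff inner_commute)
  qed simp
  show ?thesis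
  proof (rule tendsto_at_right_sequentially[of 0 1])
    fix S :: "nat \<Rightarrow> real"
    assume pos: "\<And>n. 0 < S n" and S: "decseq S" "S \<longlonglongrightarrow> 0"
    have step: "(norm (X (S m) - X (S n)))\<^sup>2 \<le> (norm (X (S n)))\<^sup>2 - (norm (X (S m)))\<^sup>2"
      if "m \<le> n" for m n
      using dist_le[OF pos[of n] decseqD[OF S(1) that]] .
    have "incseq (\<lambda>n. (norm (X (S n)))\<^sup>2)"
    proof (rule incseq_SucI)
      show "(norm (X (S n)))\<^sup>2 \<le> (norm (X (S (Suc n))))\<^sup>2" for n
        using step[of n "Suc n"] zero_le_power2[of "norm (X (S n) - X (S (Suc n)))"] by linarith
    qed
    moreover have "\<forall>n. (norm (X (S n)))\<^sup>2 \<le> (norm u)\<^sup>2"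
      using energy[OF pos] by (simp add: power_mono)
    ultimately obtain l where l: "(\<lambda>n. (norm (X (S n)))\<^sup>2) \<longlonglongrightarrow> l"
      and le_l: "\<forall>n. (norm (X (S n)))\<^sup>2 \<le> l"
      by (rule incseq_convergent)
    have "Cauchy (\<lambda>n. X (S n))"
    proof (rule CauchyI')
      fix e :: real assume e: "0 < e"
      then have "eventually (\<lambda>n. l - e\<^sup>2 < (norm (X (S n)))\<^sup>2) sequentially"
        using order_tendstoD(1)[OF l] by simp
      then obtain N where N: "\<And>n. N \<le> n \<Longrightarrow> l - e\<^sup>2 < (norm (X (S n)))\<^sup>2"
        by (auto simp: eventually_sequentially)
      have "dist (X (S m)) (X (S n)) < e" if "N \<le> m" "m < n" for m n
      proof -
        have "(norm (X (S m) - X (S n)))\<^sup>2 < e\<^sup>2"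
          using step[of m n] N[of m] le_l[rule_format, of n] that by simp
        then show ?thesis using e by (simp add: dist_norm power2_less_imp_less)
      qed
      then show "\<exists>M. \<forall>m\<ge>M. \<forall>n>m. dist (X (S m)) (X (S n)) < e" by blast
    qed
    then obtain z where z: "(\<lambda>n. X (S n)) \<longlonglongrightarrow> z"
      using Cauchy_convergent convergent_def by blast
    have "(\<lambda>n. (norm (A (X (S n) - u)))\<^sup>2) \<longlonglongrightarrow> 0"
    proof (rule Lim_null_comparison)
      show "\<forall>\<^sub>F n in sequentially.
          norm ((norm (A (X (S n) - u)))\<^sup>2) \<le> S n * (2 * (norm u)\<^sup>2)"
        using energy[OF pos] by simp
      show "(\<lambda>n. S n * (2 * (norm u)\<^sup>2)) \<longlonglongrightarrow> 0" by (rule tendsto_mult_left_zero[OF S(2)])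
    qed
    moreover have "(\<lambda>n. (norm (A (X (S n) - u)))\<^sup>2) \<longlonglongrightarrow> (norm (A (z - u)))\<^sup>2"
      by (intro tendsto_intros A.tendsto z)
    ultimately have "(norm (A (z - u)))\<^sup>2 = 0" by (rule LIMSEQ_unique[symmetric])
    then have "A z = A u" by (simp add: A.diff)
    then have "z = u" using \<open>inj A\<close> by (simp add: inj_eq)
    then show "(\<lambda>n. X (S n)) \<longlonglongrightarrow> u" using z by simp
  qed simp
qed

lemma solves_mixed_iff_operator_equation:
  fixes b :: "'v::{real_inner, complete_space} \<Rightarrow> 'm::{real_inner, complete_space} \<Rightarrow> real"
    and C :: "'v \<Rightarrow> 'o::{real_inner, complete_space}"
  assumes b: "bounded_bilinear b"
    and Cadj: "\<And>q v. Cadj q \<bullet> v = q \<bullet> C v"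
  shows "solves_mixed b C f \<epsilon> (u, l) \<longleftrightarrow>
    \<epsilon> *\<^sub>R u + Cadj (C u) + assoc_op (\<lambda>l v. b v l) l = Cadj f \<and> l - assoc_op b u = 0"
proof -
  note Badj = assoc_op_inner[OF bounded_bilinear.flip[OF b]]
  have "\<epsilon> *\<^sub>R u + Cadj (C u) + assoc_op (\<lambda>l v. b v l) l = Cadj f \<longleftrightarrow>
      (\<forall>v. \<epsilon> * (u \<bullet> v) + C u \<bullet> C v + b v l = f \<bullet> C v)"
    by (subst vector_eq_rdot[symmetric]) (simp add: inner_add_left Cadj Badj)
  moreover have "l - assoc_op b u = 0 \<longleftrightarrow> (\<forall>\<mu>. b u \<mu> - l \<bullet> \<mu> = 0)"
    by (subst vector_eq_rdot[symmetric]) (auto simp: inner_diff_left assoc_op_inner[OF b])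
  ultimately show ?thesis by (auto simp: solves_mixed_def)
qed

lemma mixed_problem_unique_solution:
  fixes b :: "'v::{real_inner, complete_space} \<Rightarrow> 'm::{real_inner, complete_space} \<Rightarrow> real"
    and C :: "'v \<Rightarrow> 'o::{real_inner, complete_space}"
  assumes b: "bounded_bilinear b" and C: "bounded_linear C" and \<epsilon>: "0 < \<epsilon>"
  shows "\<exists>!p. solves_mixed b C f \<epsilon> p"
proof -
  define Cadj where "Cadj = assoc_op (\<lambda>q v. q \<bullet> C v)"
  define Badj where "Badj = assoc_op (\<lambda>l v. b v l)"
  have qC: "bounded_bilinear (\<lambda>q v. q \<bullet> C v)"
    by (rule bounded_bilinear.comp[OF bounded_bilinear_inner bounded_linear_ident C])
  note Cadj = assoc_op_inner[OF qC, folded Cadj_def]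
  note bf = bounded_bilinear.flip[OF b]
  note Badj = assoc_op_inner[OF bf, folded Badj_def]
  note bl = bounded_linear_assoc_op[OF qC, folded Cadj_def]
    bounded_linear_assoc_op[OF bf, folded Badj_def] bounded_linear_assoc_op[OF b]
  define T where "T p = (\<epsilon> *\<^sub>R fst p + Cadj (C (fst p)) + Badj (snd p),
    snd p - assoc_op b (fst p))" for p
  have "\<exists>!p. T p = (Cadj f, 0)"
  proof (rule lax_milgram)
    show "bounded_linear T"
      unfolding T_def
      by (intro bounded_linear_Pair bounded_linear_add bounded_linear_sub
          bounded_linear_compose[OF bounded_linear_scaleR_right]
          bounded_linear_compose[OF bl(1)] bounded_linear_compose[OF bl(2)]
          bounded_linear_compose[OF bl(3)] bounded_linear_compose[OF C]
          bounded_linear_fst bounded_linear_snd)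
    show "0 < min \<epsilon> 1" using \<epsilon> by simp
    show "min \<epsilon> 1 * (p \<bullet> p) \<le> T p \<bullet> p" for p
    proof -
      obtain u l where p: "p = (u, l)" by fastforce
      have "T p \<bullet> p = \<epsilon> * (u \<bullet> u) + C u \<bullet> C u + l \<bullet> l"
        by (simp add: p T_def inner_add_left inner_diff_left Cadj Badj assoc_op_inner[OF b])
      moreover have "min \<epsilon> 1 * (u \<bullet> u) \<le> \<epsilon> * (u \<bullet> u)" "min \<epsilon> 1 * (l \<bullet> l) \<le> 1 * (l \<bullet> l)"
        by (intro mult_right_mono; simp)+
      moreover have "min \<epsilon> 1 * (p \<bullet> p) = min \<epsilon> 1 * (u \<bullet> u) + min \<epsilon> 1 * (l \<bullet> l)"
        by (simp add: p distrib_left)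
      ultimately show ?thesis using inner_ge_zero[of "C u"] by linarith
    qed
  qed
  moreover have "solves_mixed b C f \<epsilon> p \<longleftrightarrow> T p = (Cadj f, 0)" for p
    using solves_mixed_iff_operator_equation[OF b Cadj]
    by (cases p) (simp add: T_def Badj_def)
  ultimately show ?thesis by simp
qed

theorem theorem3p1:
  fixes b :: "'v::{real_inner, complete_space} \<Rightarrow> 'm::{real_inner, complete_space} \<Rightarrow> real"
    and C :: "'v \<Rightarrow> 'o::{real_inner, complete_space}"
    and f :: 'o
  assumes "bounded_bilinear b"
    and "bounded_linear C"
    and "inj (\<lambda>u. (assoc_op b u, C u))"
  shows "(\<forall>\<epsilon>>0. \<exists>!p. solves_mixed b C f \<epsilon> p) \<and>
    (\<forall>u. assoc_op b u = 0 \<and> C u = f \<longrightarrow>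
      (\<forall>u\<^sub>\<epsilon> l\<^sub>\<epsilon>. (\<forall>\<epsilon>>0. solves_mixed b C f \<epsilon> (u\<^sub>\<epsilon> \<epsilon>, l\<^sub>\<epsilon> \<epsilon>)) \<longrightarrow>
        ((\<lambda>\<epsilon>. (u\<^sub>\<epsilon> \<epsilon>, l\<^sub>\<epsilon> \<epsilon>)) \<longlongrightarrow> (u, 0)) (at_right 0)))"
proof (intro conjI allI impI)
  show "\<exists>!p. solves_mixed b C f \<epsilon> p" if "0 < \<epsilon>" for \<epsilon>
    using mixed_problem_unique_solution[OF assms(1,2) that] .
next
  fix u U L
  assume u: "assoc_op b u = 0 \<and> C u = f"
    and sol: "\<forall>\<epsilon>>0. solves_mixed b C f \<epsilon> (U \<epsilon>, L \<epsilon>)"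
  note B = bounded_linear_assoc_op[OF assms(1)]
  interpret B: bounded_linear "assoc_op b" by (fact B)
  interpret C: bounded_linear C by fact
  have L: "L \<epsilon> = assoc_op b (U \<epsilon>)" if "0 < \<epsilon>" for \<epsilon>
    by (rule assoc_op_unique[symmetric]) (use sol that in \<open>auto simp: solves_mixed_def\<close>)
  have U: "(U \<longlongrightarrow> u) (at_right 0)"
  proof (rule tikhonov_convergence[OF bounded_linear_Pair[OF B assms(2)] assms(3)])
    fix \<epsilon> :: real and v assume \<epsilon>: "0 < \<epsilon>"
    have "b v (L \<epsilon>) = assoc_op b (U \<epsilon>) \<bullet> assoc_op b v"
      by (simp add: L[OF \<epsilon>] assoc_op_inner[OF assms(1), symmetric] inner_commute)
    moreover have "\<epsilon> * (U \<epsilon> \<bullet> v) + C (U \<epsilon>) \<bullet> C v + b v (L \<epsilon>) = f \<bullet> C v"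
      using sol \<epsilon> by (simp add: solves_mixed_def)
    ultimately show "\<epsilon> * (U \<epsilon> \<bullet> v)
        + (assoc_op b (U \<epsilon> - u), C (U \<epsilon> - u)) \<bullet> (assoc_op b v, C v) = 0"
      using u by (simp add: B.diff C.diff inner_diff_left)
  qed
  have "((\<lambda>\<epsilon>. assoc_op b (U \<epsilon>)) \<longlongrightarrow> 0) (at_right 0)"
    using B.tendsto[OF U] u by simp
  moreover have "eventually (\<lambda>\<epsilon>. assoc_op b (U \<epsilon>) = L \<epsilon>) (at_right 0)"
    using L by (auto simp: eventually_at_right_less eventually_at_filter)
  ultimately have "(L \<longlongrightarrow> 0) (at_right 0)" by (rule Lim_transform_eventually)
  with U show "((\<lambda>\<epsilon>. (U \<epsilon>, L \<epsilon>)) \<longlongrightarrow> (u, 0)) (at_right 0)" by (rule tendsto_Pair)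
qed

end
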